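(* Let $p$ be an odd prime and $q$ a power of $p$. (i) Let $i$ be an integer with $0<i\le\frac12(p-1)$ and $n=q^{p+2i-1}-q^p-1$. Then for $x\in\mathbb{F}_{q^2}$, $g_{n,q}(x)=2(i-1)x^{q-2}$ if $x\in\mathbb{F}_q$, and $g_{n,q}(x)=\frac{2i-1}{x}+\frac{2i-2}{x^q}$ if $x\in\mathbb{F}_{q^2}\setminus\mathbb{F}_q$. (ii) For $n$ as in (i), $g_{n,q}$ is a permutation polynomial of $\mathbb{F}_{q^2}$ if and only if $i>1$ and $4i\not\equiv 3\pmod p$.
   Context: For a prime $p$, a power $q$ of $p$ and an integer $n\ge 0$, $g_{n,q}\in\mathbb{F}_p[x]$ is the unique polynomial with $\sum_{a\in\mathbb{F}_q}(x+a)^n=g_{n,q}(x^q-x)$. A permutation polynomial of a finite field $\mathbb{F}$ is a polynomial inducing a bijection of $\mathbb{F}$. *)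

theory Defs
  imports "HOL-Library.Cardinality" "HOL-Computational_Algebra.Computational_Algebra" "HOL-Number_Theory.Cong"
begin

text \<open>
  The subfield of order \<open>q\<close> of a finite field, as the fixed points of \<open>a \<mapsto> a ^ q\<close>.
  The lemmas \<open>card_GF\<close>, \<open>GF_closed\<close> and \<open>GF_unique\<close> below show that, inside a field with \<open>q\<^sup>2\<close>
  elements, this is a subfield with \<open>q\<close> elements and the only one.
\<close>

definition GF :: "nat \<Rightarrow> 'a::finite_field set" where
  "GF q = {a. a ^ q = a}"

text \<open>
  The defining property of \<open>g\<^sub>n\<^sub>,\<^sub>q\<close>, an identity of polynomials and not only of functions.
  The field \<open>\<F>\<^sub>p\<close> is the prime field of the ambient finite field \<open>'a\<close>, so that
  elements of \<open>\<F>\<^sub>p[x]\<close> are polynomials over \<open>'a\<close> with all coefficients in \<open>GF CHAR('a)\<close>.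
\<close>

definition is_g_poly :: "nat \<Rightarrow> nat \<Rightarrow> 'a::finite_field poly \<Rightarrow> bool" where
  "is_g_poly n q g \<longleftrightarrow>
     (\<forall>i. coeff g i \<in> GF CHAR('a)) \<and>
     (\<Sum>a\<in>GF q. ([:0, 1:] + [:a:]) ^ n) = pcompose g ([:0, 1:] ^ q - [:0, 1:])"

text \<open>Existence and uniqueness are the lemma \<open>ex1_g_poly\<close>.\<close>

definition g_poly :: "nat \<Rightarrow> nat \<Rightarrow> 'a::finite_field poly" where
  "g_poly n q = (THE g. is_g_poly n q g)"

definition permutation_poly :: "'a::finite_field poly \<Rightarrow> bool" where
  "permutation_poly f \<longleftrightarrow> bij (poly f)"


lemma prime_CHAR: "prime CHAR('a::finite_field)"
  by (rule prime_CHAR_semidom) (rule CHAR_pos)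

lemma CHAR_eqI:
  assumes "prime p" "CARD('a::finite_field) = p ^ k"
  shows "CHAR('a) = p"
proof -
  have "(\<Sum>x\<in>UNIV. x + 1 :: 'a) = (\<Sum>x\<in>UNIV. x)"
    by (rule sum.reindex_bij_witness[of _ "\<lambda>x. x - 1" "\<lambda>x. x + 1"]) auto
  then have "of_nat CARD('a) = (0 :: 'a)" by (simp add: sum.distrib)
  then have "CHAR('a) dvd p ^ k" using assms(2) of_nat_eq_0_iff_char_dvd by metis
  then have "CHAR('a) dvd p" using prime_CHAR[where ?'a='a] prime_dvd_power by blast
  then show ?thesis using prime_CHAR[where ?'a='a] assms(1) primes_dvd_imp_eq by blast
qed

lemma GF_closed:
  fixes a b :: "'a::finite_field"
  assumes "q = CHAR('a) ^ k"
  shows "0 \<in> (GF q :: 'a set)" "1 \<in> (GF q :: 'a set)"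
    "a \<in> GF q \<Longrightarrow> b \<in> GF q \<Longrightarrow> a + b \<in> GF q"
    "a \<in> GF q \<Longrightarrow> - a \<in> GF q"
    "a \<in> GF q \<Longrightarrow> b \<in> GF q \<Longrightarrow> a - b \<in> GF q"
    "a \<in> GF q \<Longrightarrow> b \<in> GF q \<Longrightarrow> a * b \<in> GF q"
    "a \<in> GF q \<Longrightarrow> inverse a \<in> GF q"
proof -
  have q0: "q > 0" using assms prime_CHAR[where ?'a='a] prime_gt_0_nat by auto
  have add: "(x + y) ^ q = x ^ q + y ^ q" for x y :: 'a
    using freshmans_dream'[OF prime_CHAR assms] by auto
  show zero: "0 \<in> (GF q :: 'a set)" using q0 by (simp add: GF_def)
  show "1 \<in> (GF q :: 'a set)" by (simp add: GF_def)
  show 1: "a \<in> GF q \<Longrightarrow> b \<in> GF q \<Longrightarrow> a + b \<in> GF q" for a b :: 'a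
    by (simp add: GF_def add)
  show 2: "a \<in> GF q \<Longrightarrow> - a \<in> GF q" for a :: 'a
    using add[of a "- a"] q0 minus_unique[of a "(- a) ^ q"] by (auto simp: GF_def power_0_left)
  show "a \<in> GF q \<Longrightarrow> b \<in> GF q \<Longrightarrow> a - b \<in> GF q"
    using 1[of a "- b"] 2[of b] by simp
  show "a \<in> GF q \<Longrightarrow> b \<in> GF q \<Longrightarrow> a * b \<in> GF q"
    by (simp add: GF_def power_mult_distrib)
  show "a \<in> GF q \<Longrightarrow> inverse a \<in> GF q"
    by (simp add: GF_def power_inverse)
qed

lemma degree_artin_schreier:
  assumes "q \<ge> 2"
  shows "degree ([:0, 1:] ^ q - [:0, 1:] :: 'a::finite_field poly) = q"
proof -
  have "degree ([:0, 1:] ^ q :: 'a poly) = q" by (simp add: degree_power_eq)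
  then show ?thesis using assms
    by (subst diff_conv_add_uminus, subst degree_add_eq_left) auto
qed

lemma card_GF:
  assumes "CARD('a::finite_field) = q ^ 2" "q \<ge> 2"
  shows "card (GF q :: 'a set) = q"
proof -
  let ?X = "[:0, 1:] :: 'a poly"
  let ?L = "?X ^ q - ?X"
  have L0: "?L \<noteq> 0" using degree_artin_schreier[OF assms(2), where ?'a='a] assms(2) by auto
  have GF_roots: "GF q = {x. poly ?L x = 0}" by (auto simp: GF_def)
  have le: "card (GF q :: 'a set) \<le> q"
    using card_poly_roots_bound[OF L0] degree_artin_schreier[OF assms(2), where ?'a='a]
    by (simp add: GF_roots)
  have "?X ^ (q - 1) - 1 dvd (?X ^ (q - 1)) ^ (q + 1) - 1"
    using power_diff_1_eq[of "?X ^ (q - 1)" "q + 1"] by (metis dvd_triv_left)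
  then have "?X * (?X ^ (q - 1) - 1) dvd ?X * ((?X ^ (q - 1)) ^ (q + 1) - 1)"
    by (intro mult_dvd_mono) auto
  moreover have "?X * (?X ^ (q - 1) - 1) = ?L"
    using assms(2) by (simp only: right_diff_distrib mult_1_right power_Suc[symmetric])
      (simp add: Suc_diff_1)
  moreover have "?X * ((?X ^ (q - 1)) ^ (q + 1) - 1) = ?X ^ (q ^ 2) - ?X"
  proof -
    have "Suc ((q - 1) * (q + 1)) = q ^ 2"
      using assms(2) by (cases q) (auto simp: power2_eq_square)
    then show ?thesis
      by (simp only: right_diff_distrib mult_1_right power_Suc[symmetric] power_mult[symmetric])
  qed
  ultimately have "?L dvd ?X ^ (q ^ 2) - ?X" by simp
  then obtain h where h: "?X ^ (q ^ 2) - ?X = ?L * h" unfolding dvd_def by blast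
  have q2: "q ^ 2 \<ge> 2" using assms(2) by (metis power2_nat_le_imp_le le_trans self_le_power zero_less_numeral one_le_numeral power_increasing numeral_le_one_iff le_numeral_extra(4) power2_eq_square mult_le_mono mult_1_right)
  have deg: "degree (?X ^ (q ^ 2) - ?X) = q ^ 2" by (rule degree_artin_schreier[OF q2])
  then have h0: "h \<noteq> 0" using h assms(2) by auto
  then have degh: "q + degree h = q ^ 2"
    using deg degree_mult_eq[OF L0 h0] degree_artin_schreier[OF assms(2), where ?'a='a] h by simp
  have "(UNIV :: 'a set) \<subseteq> GF q \<union> {x. poly h x = 0}"
  proof
    fix x :: 'a
    have "x ^ (q ^ 2) = x" using finite_field_power_card_eq_same[of x] assms(1) by simp
    then have "poly (?L * h) x = 0" by (simp flip: h)
    then show "x \<in> GF q \<union> {x. poly h x = 0}" by (auto simp: GF_def)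
  qed
  then have "CARD('a) \<le> card (GF q \<union> {x::'a. poly h x = 0})" by (intro card_mono) auto
  also have "\<dots> \<le> card (GF q :: 'a set) + card {x::'a. poly h x = 0}" by (rule card_Un_le)
  also have "\<dots> \<le> card (GF q :: 'a set) + degree h"
    using card_poly_roots_bound[OF h0] by simp
  finally show ?thesis using le degh assms(1) by simp
qed

lemma GF_unique:
  fixes K :: "'a::finite_field set"
  assumes "CARD('a) = q ^ 2" "q \<ge> 2" "card K = q"
    and closed: "0 \<in> K" "\<And>a b. a \<in> K \<Longrightarrow> b \<in> K \<Longrightarrow> a * b \<in> K"
  shows "K = GF q"
proof -
  have fin: "finite (K - {0})" by simp
  have "a ^ q = a" if "a \<in> K" for a
  proof (cases "a = 0")
    case False
    have inj: "inj_on ((*) a) (K - {0})" using False by (auto intro: inj_onI)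
    have sub: "(*) a ` (K - {0}) \<subseteq> K - {0}" using False that closed(2) by auto
    have "(*) a ` (K - {0}) = K - {0}" by (rule endo_inj_surj[OF fin sub inj])
    then have "\<Prod>(K - {0}) = (\<Prod>x\<in>K - {0}. a * x)"
      using prod.reindex[OF inj, of id] by simp
    also have "\<dots> = a ^ (q - 1) * \<Prod>(K - {0})"
      using assms(3) closed(1) by (simp add: prod.distrib card_Diff_singleton)
    finally have "a ^ (q - 1) = 1" using fin by (simp add: prod_zero_iff)
    then show ?thesis using assms(2) by (metis mult.right_neutral power_minus_mult mult_1 zero_less_numeral less_le_trans)
  qed (use assms(2) in simp)
  then have "K \<subseteq> GF q" by (auto simp: GF_def)
  then show ?thesis using card_GF[OF assms(1,2)] assms(3) by (intro card_subset_eq) auto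
qed

lemma pcompose_pow: "pcompose (f ^ n) h = pcompose f h ^ n"
  for f h :: "'a::comm_semiring_1 poly"
  by (induction n) (simp_all add: pcompose_1 pcompose_mult)

lemma translation_invariant_imp_pcompose:
  fixes P :: "'a::finite_field poly"
  assumes card: "CARD('a) = q ^ 2" "q = CHAR('a) ^ k" "q \<ge> 2"
    and "\<And>i. coeff P i \<in> GF CHAR('a)"
    and "\<And>a. a \<in> GF q \<Longrightarrow> pcompose P [:a, 1:] = P"
  shows "\<exists>g. (\<forall>i. coeff g i \<in> GF CHAR('a)) \<and> P = pcompose g ([:0, 1:] ^ q - [:0, 1:])"
  using assms(4,5)
proof (induction "degree P" arbitrary: P rule: less_induct)
  case less
  let ?X = "[:0, 1:] :: 'a poly"
  define L where "L = ?X ^ q - ?X"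
  note cl = GF_closed[where ?'a='a, of "CHAR('a)" 1, simplified]
  have degL: "degree L = q" unfolding L_def by (rule degree_artin_schreier[OF card(3)])
  have L0: "L \<noteq> 0" using degL card(3) by auto
  show ?case
  proof (cases "degree P = 0")
    case True
    then obtain c where "P = [:c:]" by (auto elim: degree_eq_zeroE)
    then show ?thesis using less.prems(1) by (intro exI[of _ P]) auto
  next
    case False
    define R where "R = P - [:coeff P 0:]"
    have R0: "R \<noteq> 0" using False unfolding R_def by (metis degree_pCons_0 eq_iff_diff_eq_0)
    have root: "poly R a = 0" if "a \<in> GF q" for a
      using arg_cong[OF less.prems(2)[OF that], of "\<lambda>f. poly f 0"]
      by (simp add: R_def poly_pcompose poly_0_coeff_0)
    have "R mod L = 0"
    proof (rule ccontr)
      assume nz: "R mod L \<noteq> 0"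
      have "GF q \<subseteq> {x. poly (R mod L) x = 0}"
      proof
        fix a :: 'a assume a: "a \<in> GF q"
        have "poly L a = 0" using a by (simp add: L_def GF_def)
        moreover have "poly R a = poly (R div L * L + R mod L) a" by simp
        ultimately show "a \<in> {x. poly (R mod L) x = 0}" using root[OF a]
          by (simp only: poly_add poly_mult) simp
      qed
      then have "q \<le> card {x. poly (R mod L) x = 0}"
        using card_GF[OF card(1,3)] card_mono[OF _ \<open>GF q \<subseteq> _\<close>] by simp
      also have "\<dots> \<le> degree (R mod L)" by (rule card_poly_roots_bound[OF nz])
      also have "\<dots> < q" using degree_mod_less[OF L0, of R] nz degL by auto
      finally show False by simp
    qed
    then obtain Q where Q: "R = L * Q" by (auto simp: dvd_eq_mod_eq_0[symmetric] dvd_def)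
    have Q0: "Q \<noteq> 0" using Q R0 by auto
    have degR: "degree R = degree P" unfolding R_def using False
      by (subst diff_conv_add_uminus, subst degree_add_eq_left) auto
    have degQ: "degree Q < degree P"
      using degree_mult_eq[OF L0 Q0] degL card(3) degR Q by simp
    have R_coeff: "coeff R (Suc j) = (if Suc j < q then 0 else coeff Q (Suc j - q)) - coeff Q j" for j
    proof -
      have "R = monom 1 q * Q - pCons 0 Q"
        by (simp add: Q L_def left_diff_distrib monom_altdef)
      then show ?thesis by (simp add: coeff_monom_mult)
    qed
    note P_coeff = less.prems(1)
    have Q_coeff: "coeff Q j \<in> GF CHAR('a)" for j
    proof (induction j rule: less_induct)
      case (less j)
      have "coeff Q j = (if Suc j < q then 0 else coeff Q (Suc j - q)) - coeff P (Suc j)"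
        using R_coeff[of j] by (simp add: R_def algebra_simps)
      moreover have "(if Suc j < q then 0 else coeff Q (Suc j - q)) \<in> GF CHAR('a)"
        using less[of "Suc j - q"] card(3) cl(1) by auto
      ultimately show ?case using P_coeff cl(5) by metis
    qed
    have Q_inv: "pcompose Q [:a, 1:] = Q" if a: "a \<in> GF q" for a
    proof -
      have ext: "([:a, 1:] :: 'a poly) = ?X + [:a:]" by simp
      have "pcompose L [:a, 1:] = [:a, 1:] ^ q - [:a, 1:]"
        by (simp add: L_def pcompose_diff pcompose_pow pcompose_pCons)
      also have "([:a, 1:] :: 'a poly) ^ q = ?X ^ q + [:a:] ^ q"
        unfolding ext by (rule freshmans_dream') (use card(2) prime_CHAR[where ?'a='a] in simp_all)
      also have "([:a:] :: 'a poly) ^ q = [:a:]"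
        using a by (simp add: GF_def poly_const_pow)
      finally have "pcompose L [:a, 1:] = L" by (simp add: L_def)
      moreover have "pcompose R [:a, 1:] = R"
        using less.prems(2)[OF a] by (simp add: R_def pcompose_diff)
      ultimately have "L * pcompose Q [:a, 1:] = L * Q" by (metis Q pcompose_mult)
      then show ?thesis using L0 by simp
    qed
    obtain g where g: "\<forall>i. coeff g i \<in> GF CHAR('a)" "Q = pcompose g L"
      using less.hyps[OF degQ Q_coeff Q_inv] L_def by auto
    have "P = pcompose (pCons (coeff P 0) g) L"
      using Q g(2) by (simp add: R_def pcompose_pCons algebra_simps)
    moreover have "coeff (pCons (coeff P 0) g) i \<in> GF CHAR('a)" for i
      using g(1) less.prems(1) by (cases i) auto
    ultimately show ?thesis unfolding L_def by blast
  qed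
qed

lemma ex1_g_poly:
  assumes "CARD('a::finite_field) = q ^ 2" "q = CHAR('a) ^ k" "q \<ge> 2"
  shows "\<exists>!g :: 'a poly. is_g_poly n q g"
proof -
  let ?p = "CHAR('a)"
  let ?L = "[:0, 1:] ^ q - [:0, 1:] :: 'a poly"
  define S :: "'a poly" where "S = (\<Sum>a\<in>GF q. [:a, 1:] ^ n)"
  have p: "prime ?p" by (rule prime_CHAR)
  note cl = GF_closed[where ?'a='a, OF assms(2)]
  have uniq: "g = h" if "pcompose g ?L = pcompose h ?L" for g h
  proof -
    have "pcompose (g - h) ?L = 0" using that by (simp add: pcompose_diff)
    then have "g - h = 0"
      by (rule pcompose_eq_0) (use degree_artin_schreier[OF assms(3), where ?'a='a] assms(3) in simp)
    then show ?thesis by simp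
  qed
  have bij_frob: "bij_betw (\<lambda>a. a ^ ?p) (GF q) (GF q :: 'a set)"
  proof -
    have inj: "inj_on (\<lambda>a::'a. a ^ ?p) (GF q)"
    proof (rule inj_onI)
      fix a b :: 'a assume "a ^ ?p = b ^ ?p"
      moreover have "((a - b) + b) ^ ?p = (a - b) ^ ?p + b ^ ?p"
        by (rule freshmans_dream) (use p in simp_all)
      ultimately have "(a - b) ^ ?p = 0" by simp
      then show "a = b" by simp
    qed
    have "(\<lambda>a. a ^ ?p) ` GF q \<subseteq> (GF q :: 'a set)"
      by (auto simp: GF_def power_mult[symmetric] mult.commute)
         (simp add: power_mult mult.commute)
    then show ?thesis using inj endo_inj_surj[OF _ _ inj] by (auto simp: bij_betw_def)
  qed
  have S_coeff: "coeff S i \<in> GF ?p" for i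
  proof -
    have c: "coeff ([:a, 1:] ^ n) i = of_nat (n choose i) * a ^ (n - i)" for a :: 'a
      using coeff_linear_poly_power[of i n a 1] coeff_eq_0[of "[:a, 1:] ^ n" i]
      by (cases "i \<le> n") (auto simp: degree_linear_power binomial_eq_0)
    have ofn: "(of_nat m :: 'a) ^ ?p = of_nat m" for m
    proof (induction m)
      case (Suc m)
      then show ?case using freshmans_dream[OF p refl, of 1 "of_nat m :: 'a"] by simp
    qed (use p in \<open>simp add: prime_gt_0_nat\<close>)
    have "coeff S i = (\<Sum>a\<in>GF q. of_nat (n choose i) * a ^ (n - i))"
      by (simp add: S_def coeff_sum c)
    moreover have "\<dots> ^ ?p = (\<Sum>a\<in>GF q. of_nat (n choose i) * (a ^ ?p) ^ (n - i))"
      by (subst freshmans_dream_sum[OF p])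
         (simp_all add: power_mult_distrib ofn power_mult[symmetric] mult.commute)
    moreover have "\<dots> = (\<Sum>a\<in>GF q. of_nat (n choose i) * a ^ (n - i))"
      by (rule sum.reindex_bij_betw[OF bij_frob])
    ultimately show ?thesis by (simp add: GF_def)
  qed
  have S_inv: "pcompose S [:b, 1:] = S" if b: "b \<in> GF q" for b
  proof -
    have "pcompose S [:b, 1:] = (\<Sum>a\<in>GF q. [:a + b, 1:] ^ n)"
      by (simp add: S_def pcompose_sum pcompose_pow pcompose_pCons)
    also have "\<dots> = S" unfolding S_def
      by (rule sum.reindex_bij_witness[of _ "\<lambda>a. a - b" "\<lambda>a. a + b"]) (use b cl in auto)
    finally show ?thesis .
  qed
  obtain g where g: "\<forall>i. coeff g i \<in> GF ?p" "S = pcompose g ?L"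
    using translation_invariant_imp_pcompose[OF assms S_coeff S_inv] by blast
  have "is_g_poly n q h \<longleftrightarrow> (\<forall>i. coeff h i \<in> GF ?p) \<and> S = pcompose h ?L" for h
    by (simp add: is_g_poly_def S_def)
  then show ?thesis using g uniq by metis
qed

end

theory Submission
  imports Defs
begin

text \<open>
  If \<open>x = y ^ q - y\<close>, then \<open>g\<^sub>n\<^sub>,\<^sub>q(x)\<close> is the sum of the \<open>z ^ n\<close> over \<open>z = y + a\<close> with \<open>a\<close> in the field
  of order \<open>q\<close>. For \<open>x\<close> in the field of order \<open>q\<^sup>2\<close> every power \<open>z ^ (q ^ j)\<close> is a translate of \<open>z\<close>,
  and \<open>z ^ n = (z + c) / (z * (z + d))\<close> with \<open>c = (2 * i - 1) / 2 * (x + x ^ q)\<close> and \<open>d = (x - x ^ q) / 2\<close>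
  if \<open>x\<close> is not \<open>0\<close>. Partial fractions reduce the sum to sums of \<open>1 / z\<close> and \<open>1 / z\<^sup>2\<close>. Instead of adjoining \<open>y\<close> to
  the field, we compute with polynomials in an indeterminate \<open>Y\<close> modulo \<open>Y ^ q - Y - x\<close>.
\<close>

section \<open>The q-th power map and the subfield of order q\<close>

lemma linear_power_q:
  fixes c :: "'a::finite_field"
  assumes "q = CHAR('a) ^ k"
  shows "[:c, 1:] ^ q = [:0, 1:] ^ q + [:c ^ q:]"
proof -
  have "([:c, 1:] :: 'a poly) = [:0, 1:] + [:c:]" by simp
  also have "\<dots> ^ q = [:0, 1:] ^ q + [:c:] ^ q"
    by (rule freshmans_dream') (use assms prime_CHAR[where ?'a='a] in simp_all)
  finally show ?thesis by (simp add: poly_const_pow)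
qed

lemma add_power_q:
  fixes a b :: "'a::finite_field"
  assumes "q = CHAR('a) ^ k"
  shows "(a + b) ^ q = a ^ q + b ^ q"
  using freshmans_dream'[OF prime_CHAR assms] by auto

lemma of_nat_in_GF:
  assumes "q = CHAR('a::finite_field) ^ k"
  shows "of_nat m \<in> (GF q :: 'a set)"
  by (induction m) (use GF_closed(1-3)[OF assms] in auto)

lemma of_nat_q_eq_0:
  assumes "q = CHAR('a::finite_field) ^ k" "q \<ge> 2"
  shows "of_nat q = (0 :: 'a)"
  using assms by (cases k) auto

lemma power_q_q:
  fixes x :: "'a::finite_field"
  assumes "CARD('a) = q ^ 2"
  shows "(x ^ q) ^ q = x"
  using finite_field_power_card_eq_same[of x] assms
  by (simp add: power_mult[symmetric] power2_eq_square)

text \<open>\<open>P - [:v:]\<close> would have q roots but degree below q. Sums of powers of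
  \<open>Y + a\<close> with exponent below q can thus be found by evaluating at points of
  \<open>GF q\<close> alone.\<close>

lemma poly_const_on_GF:
  fixes P :: "'a::finite_field poly"
  assumes "CARD('a) = q ^ 2" "q \<ge> 2" "degree P < q"
    and "\<And>b. b \<in> GF q \<Longrightarrow> poly P b = v"
  shows "P = [:v:]"
proof (rule ccontr)
  assume "P \<noteq> [:v:]"
  then have nz: "P - [:v:] \<noteq> 0" by simp
  have "GF q \<subseteq> {b. poly (P - [:v:]) b = 0}" using assms(4) by auto
  then have "q \<le> card {b. poly (P - [:v:]) b = 0}"
    using card_GF[OF assms(1,2)] card_mono[of "{b. poly (P - [:v:]) b = 0}" "GF q"] by simp
  also have "\<dots> \<le> degree (P - [:v:])" by (rule card_poly_roots_bound[OF nz])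
  also have "\<dots> < q" using assms(2,3) by (intro degree_diff_less) auto
  finally show False by simp
qed

lemma GF_power_pred:
  fixes a :: "'a::finite_field"
  assumes "a \<in> GF q" "a \<noteq> 0" "q \<ge> 2"
  shows "a ^ (q - 1) = 1"
proof -
  have "a ^ (q - 1) * a = a"
    using assms by (simp add: GF_def flip: power_Suc2)
  then show ?thesis using assms(2) by simp
qed

text \<open>At 0 both sides vanish, since \<open>inverse 0 = 0\<close> and the exponent is positive;
  so \<open>x ^ (q - 2)\<close> is inversion on the whole subfield.\<close>

lemma GF_power_pred2:
  fixes a :: "'a::finite_field"
  assumes "a \<in> GF q" "q > 2"
  shows "a ^ (q - 2) = inverse a"
proof (cases "a = 0")
  case False
  have "q - 1 = Suc (q - 2)" using assms(2) by simp
  then have "a ^ (q - 2) * a = 1"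
    using GF_power_pred[OF assms(1) False] assms(2) by (simp only: power_Suc2)
  then show ?thesis using False by (simp add: nonzero_eq_divide_eq inverse_eq_divide)
qed (use assms(2) in simp)

section \<open>Power sums over the subfield\<close>

lemma sum_translate_GF:
  fixes b :: "'a::finite_field" and f :: "'a \<Rightarrow> 'b::comm_monoid_add"
  assumes "q = CHAR('a) ^ k" "b \<in> GF q"
  shows "(\<Sum>a\<in>GF q. f (a + b)) = (\<Sum>a\<in>GF q. f a)"
  by (rule sum.reindex_bij_witness[of _ "\<lambda>a. a - b" "\<lambda>a. a + b"])
    (use assms GF_closed[OF assms(1)] in auto)

text \<open>The substitution of \<open>- a\<close> for \<open>a\<close> negates the sum, and 2 is
  invertible.\<close>

lemma sum_odd_power_GF:
  assumes "q = CHAR('a::finite_field) ^ k" "odd q" "k \<ge> 1" "odd m"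
  shows "(\<Sum>a\<in>GF q. (a :: 'a) ^ m) = 0"
proof -
  have "(\<Sum>a\<in>GF q. (a :: 'a) ^ m) = (\<Sum>a\<in>GF q. - (a ^ m))"
    by (rule sum.reindex_bij_witness[of _ uminus uminus])
      (use assms GF_closed(4)[OF assms(1)] in auto)
  then have "(\<Sum>a\<in>GF q. (a :: 'a) ^ m) + (\<Sum>a\<in>GF q. a ^ m) = 0"
    by (simp only: sum_negf eq_neg_iff_add_eq_0)
  then have "of_nat 2 * (\<Sum>a\<in>GF q. (a :: 'a) ^ m) = 0" by (simp only: of_nat_numeral mult_2)
  moreover have "(of_nat 2 :: 'a) \<noteq> 0"
  proof
    assume "(of_nat 2 :: 'a) = 0"
    then have "CHAR('a) dvd 2" by (simp only: of_nat_eq_0_iff_char_dvd)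
    then have "CHAR('a) = 2" using prime_CHAR[where ?'a='a] primes_dvd_imp_eq two_is_prime_nat by blast
    then show False using assms by simp
  qed
  ultimately show ?thesis by simp
qed

lemma degree_sum_linear_power_less:
  assumes "m < q"
  shows "degree (\<Sum>a\<in>A. [:a, 1 :: 'a::field:] ^ m) < q"
  by (rule degree_sum_less) (use assms in \<open>auto simp: degree_linear_power\<close>)

lemma sum_linear_power_pred:
  assumes "CARD('a::finite_field) = q ^ 2" "q = CHAR('a) ^ k" "q \<ge> 2"
  shows "(\<Sum>a\<in>GF q. [:a + d, 1 :: 'a:] ^ (q - 1)) = - 1"
proof -
  let ?P = "\<Sum>a\<in>GF q. [:a, 1 :: 'a:] ^ (q - 1)"
  have "?P = [:- 1:]"
  proof (rule poly_const_on_GF[OF assms(1,3)])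
    fix b :: 'a assume b: "b \<in> GF q"
    have "poly ?P b = (\<Sum>a\<in>GF q. (a + b) ^ (q - 1))"
      by (simp add: poly_sum)
    also have "\<dots> = (\<Sum>a\<in>GF q. a ^ (q - 1))"
      by (rule sum_translate_GF[OF assms(2) b])
    \<comment> \<open>Each nonzero \<open>a\<close> contributes 1, so the sum counts q - 1 elements,
      which is -1 in the field.\<close>
    also have "\<dots> = (\<Sum>a\<in>GF q - {0::'a}. a ^ (q - 1))"
      using assms(3) by (intro sum.mono_neutral_right) auto
    also have "\<dots> = (\<Sum>a\<in>GF q - {0::'a}. 1)"
      by (intro sum.cong) (use GF_power_pred assms(3) in auto)
    also have "\<dots> = of_nat q - 1"
      using card_GF[OF assms(1,3)] GF_closed(1)[OF assms(2)] assms(3)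
      by (simp add: card_Diff_singleton of_nat_diff)
    also have "of_nat q = (0 :: 'a)"
      using of_nat_q_eq_0[OF assms(2,3)] by (simp add: of_nat_poly)
    finally show "poly ?P b = - 1" by simp
  qed (rule degree_sum_linear_power_less, use assms(3) in simp)
  \<comment> \<open>A constant polynomial is unchanged under \<open>Y\<close> to
    \<open>Y + d\<close>; this reaches every shift \<open>d\<close>, also those outside
    \<open>GF q\<close>.\<close>
  then have "pcompose ?P [:d, 1:] = - 1" by (simp add: pcompose_const one_pCons)
  then show ?thesis by (simp add: pcompose_sum pcompose_pow pcompose_pCons add.commute)
qed

lemma sum_linear_power_pred2:
  assumes "CARD('a::finite_field) = q ^ 2" "q = CHAR('a) ^ k" "q \<ge> 2" "odd q" "k \<ge> 1"
  shows "(\<Sum>a\<in>GF q. [:a, 1 :: 'a:] ^ (q - 2)) = 0"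
proof -
  let ?P = "\<Sum>a\<in>GF q. [:a, 1 :: 'a:] ^ (q - 2)"
  have "?P = [:0:]"
  proof (rule poly_const_on_GF[OF assms(1,3)])
    fix b :: 'a assume b: "b \<in> GF q"
    have "poly ?P b = (\<Sum>a\<in>GF q. (a + b) ^ (q - 2))"
      by (simp add: poly_sum)
    also have "\<dots> = (\<Sum>a\<in>GF q. a ^ (q - 2))"
      by (rule sum_translate_GF[OF assms(2) b])
    also have "\<dots> = 0"
      by (rule sum_odd_power_GF) (use assms in auto)
    finally show "poly ?P b = 0" .
  qed (rule degree_sum_linear_power_less, use assms(3) in simp)
  then show ?thesis by simp
qed

section \<open>Congruences modulo \<open>Y ^ q - Y - x\<close>\<close>

lemma cong_pcompose:
  fixes g :: "'a::field poly"
  assumes "[f = h] (mod M)"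
  shows "[pcompose g f = pcompose g h] (mod M)"
  by (induction g) (auto simp: pcompose_pCons intro!: cong_add cong_mult assms)

lemma pcompose_const_right: "pcompose g [:x:] = [:poly g x:]"
  for x :: "'a::comm_semiring_0"
  by (induction g) (simp_all add: pcompose_pCons mult.commute)

lemma cong_const_imp_eq:
  fixes u v :: "'a::field"
  assumes "[[:u:] = [:v:]] (mod M)" "degree M > 0"
  shows "u = v"
  using assms by (simp add: cong_def mod_poly_less)

lemma cong_artin_schreier:
  "[[:0, 1:] ^ q - [:0, 1:] = [:x:]] (mod [:0, 1:] ^ q - [:0, 1:] - [:x :: 'a::field:])"
  by (simp add: cong_iff_dvd_diff)

text \<open>Since \<open>(Y + c) ^ q = Y ^ q + c ^ q\<close> and \<open>Y ^ q\<close> is congruent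
  to \<open>Y + x\<close>, the q-th power of a translate of \<open>Y\<close> is again a
  translate.\<close>

lemma cong_linear_power_Suc:
  fixes x a c :: "'a::finite_field"
  assumes "q = CHAR('a) ^ k"
  defines "M \<equiv> [:0, 1:] ^ q - [:0, 1:] - [:x:]"
  assumes "[[:a, 1:] ^ (q ^ j) = [:c, 1:]] (mod M)"
  shows "[[:a, 1:] ^ (q ^ Suc j) = [:x + c ^ q, 1:]] (mod M)"
proof -
  have "[[:a, 1:] ^ (q ^ Suc j) = [:c, 1:] ^ q] (mod M)"
    using cong_pow[OF assms(3), of q] by (simp add: power_mult[symmetric] mult.commute)
  also have "[:c, 1:] ^ q = [:x + c ^ q, 1:] + M"
    unfolding M_def by (subst linear_power_q[OF assms(1)]) simp
  also have "[\<dots> = [:x + c ^ q, 1:]] (mod M)" by (simp add: cong_def)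
  finally show ?thesis .
qed

text \<open>The q-th power map swaps \<open>x\<close> and \<open>x ^ q\<close> and fixes
  \<open>a\<close>, so any two successive steps add \<open>x + x ^ q\<close> to the constant term.
  The even and odd exponents feed each other in the induction.\<close>

lemma cong_linear_power:
  fixes x a :: "'a::finite_field"
  assumes "CARD('a) = q ^ 2" "q = CHAR('a) ^ k" "a \<in> GF q"
  defines "M \<equiv> [:0, 1:] ^ q - [:0, 1:] - [:x:]"
  shows "[[:a, 1:] ^ (q ^ (2 * m)) = [:a + of_nat m * (x + x ^ q), 1:]] (mod M)" (is "?A m")
    and "[[:a, 1:] ^ (q ^ (2 * m + 1)) = [:a + x + of_nat m * (x + x ^ q), 1:]] (mod M)" (is "?B m")
proof -
  have pw: "of_nat m ^ q = (of_nat m :: 'a)" "a ^ q = a" for m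
    using of_nat_in_GF[OF assms(2)] assms(3) by (auto simp: GF_def)
  note step = cong_linear_power_Suc[OF assms(2), of a _ _ x, folded M_def]
  have AB: "?B m" if "?A m" for m
  proof -
    have *: "x + (a + of_nat m * (x + x ^ q)) ^ q = a + x + of_nat m * (x + x ^ q)"
      by (simp only: add_power_q[OF assms(2)] power_mult_distrib power_q_q[OF assms(1)] pw ac_simps)
    show ?thesis using step[OF that] by (simp only: * Suc_eq_plus1)
  qed
  have BA: "?A (Suc m)" if "?B m" for m
  proof -
    have "x + (a + x + of_nat m * (x + x ^ q)) ^ q = x + (a + x ^ q + of_nat m * (x ^ q + x))"
      by (simp only: add_power_q[OF assms(2)] power_mult_distrib power_q_q[OF assms(1)] pw)
    also have "\<dots> = a + of_nat (Suc m) * (x + x ^ q)" by (simp add: algebra_simps)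
    finally have *: "x + (a + x + of_nat m * (x + x ^ q)) ^ q = \<dots>" .
    have "2 * Suc m = Suc (2 * m + 1)" by simp
    then show ?thesis using step[OF that] by (simp only: *)
  qed
  show "?A m"
  proof (induction m)
    case (Suc m)
    then show ?case by (intro BA AB)
  qed simp
  then show "?B m" by (rule AB)
qed

lemma is_g_poly_g_poly:
  assumes "CARD('a::finite_field) = q ^ 2" "q = CHAR('a) ^ k" "q \<ge> 2"
  shows "is_g_poly n q (g_poly n q :: 'a poly)"
  unfolding g_poly_def by (rule theI'[OF ex1_g_poly[OF assms]])

text \<open>Modulo \<open>Y ^ q - Y - x\<close> the argument of \<open>g_poly n q\<close> in its
  defining identity becomes the constant \<open>x\<close>, so the sum of powers reduces to the value
  sought.\<close>

lemma cong_sum_g_poly: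
  fixes x :: "'a::finite_field"
  assumes "CARD('a) = q ^ 2" "q = CHAR('a) ^ k" "q \<ge> 2"
  shows "[(\<Sum>a\<in>GF q. [:a, 1:] ^ n) = [:poly (g_poly n q) x:]]
    (mod [:0, 1:] ^ q - [:0, 1:] - [:x:])"
proof -
  have "(\<Sum>a\<in>GF q. [:a, 1:] ^ n) = pcompose (g_poly n q :: 'a poly) ([:0, 1:] ^ q - [:0, 1:])"
    using is_g_poly_g_poly[OF assms, of n] by (simp add: is_g_poly_def)
  then show ?thesis
    using cong_pcompose[OF cong_artin_schreier[of q x], of "g_poly n q"] by (simp add: pcompose_const_right)
qed

lemma degree_artin_schreier_const:
  assumes "q \<ge> 2"
  shows "degree ([:0, 1:] ^ q - [:0, 1:] - [:x:] :: 'a::finite_field poly) > 0"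
proof -
  have "degree ([:0, 1:] ^ q - [:0, 1:] - [:x:] :: 'a poly) = q"
    using degree_artin_schreier[OF assms, where ?'a='a] assms
    by (subst diff_conv_add_uminus, subst degree_add_eq_left) auto
  then show ?thesis using assms by simp
qed

section \<open>Sums of partial fractions\<close>

lemma linear_mult_power_pred:
  fixes c :: "'a::finite_field"
  assumes "q = CHAR('a) ^ k" "q \<ge> 2"
  shows "[:c, 1:] * ([:c, 1:] ^ (q - 1) - 1) = [:0, 1:] ^ q - [:0, 1:] + [:c ^ q - c:]"
proof -
  have "[:c, 1:] * ([:c, 1:] ^ (q - 1) - 1) = [:c, 1:] ^ q - [:c, 1:]"
    using assms(2) by (simp only: right_diff_distrib flip: power_Suc) simp
  also have "\<dots> = [:0, 1:] ^ q + [:c ^ q:] - [:c, 1:]"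
    by (subst linear_power_q[OF assms(1)]) simp
  also have "\<dots> = [:0, 1:] ^ q - [:0, 1:] + [:c ^ q - c:]" by simp
  finally show ?thesis .
qed

text \<open>
  With \<open>z = Y + a\<close> and \<open>D = z ^ (q - 1) - 1\<close> we have \<open>z * D = Y ^ q - Y \<equiv> x\<close>, so that \<open>D\<close> serves as
  \<open>x / z\<close>, and the sum of the \<open>D\<close> over all \<open>a\<close> is \<open>- 1\<close>. The next two lemmas sum the partial fractions of
  \<open>(z + c) / (z * (z + d))\<close> for \<open>d \<noteq> 0\<close> and for \<open>d = 0\<close>, with the denominators cleared.
\<close>

lemma sum_partial_fractions:
  fixes x c d v :: "'a::finite_field"
  assumes "CARD('a) = q ^ 2" "q = CHAR('a) ^ k" "q \<ge> 2"
  defines "M \<equiv> [:0, 1:] ^ q - [:0, 1:] - [:x:]"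
  assumes F: "\<And>a. a \<in> GF q \<Longrightarrow> [F a * ([:a + d, 1:] * [:a, 1:]) = [:a + c, 1:]] (mod M)"
    and v: "[(\<Sum>a\<in>GF q. F a) = [:v:]] (mod M)"
  shows "d * v * (x * (x + d ^ q - d)) = - c * (x + d ^ q - d) - (d - c) * x"
proof -
  let ?L = "[:0, 1:] ^ q - [:0, 1:] :: 'a poly"
  define e where "e = d ^ q - d"
  define D where "D a = [:a, 1:] ^ (q - 1) - 1" for a :: 'a
  have z: "[:a, 1:] * D a = ?L" if "a \<in> GF q" for a
    using linear_mult_power_pred[OF assms(2,3), of a] that by (simp add: GF_def D_def)
  \<comment> \<open>The shift \<open>d\<close> need not lie in \<open>GF q\<close>; the correction
    \<open>e\<close> measures its failure to be fixed by the q-th power map.\<close>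
  have w: "[:a + d, 1:] * D (a + d) = ?L + [:e:]" if "a \<in> GF q" for a
    using linear_mult_power_pred[OF assms(2,3), of "a + d"] that
    by (simp add: GF_def D_def e_def add_power_q[OF assms(2)])
  have q0: "of_nat q = (0 :: 'a poly)"
    using of_nat_q_eq_0[OF assms(2,3)] by (simp add: of_nat_poly)
  have sumD: "(\<Sum>a\<in>GF q. D (a + d)) = - 1" for d
    using sum_linear_power_pred[OF assms(1-3), of d] card_GF[OF assms(1,3)] q0
    by (simp add: D_def sum_subtractf)
  \<comment> \<open>\<open>D (a + 0)\<close> is written so that \<open>sumD\<close> evaluates both
    sums.\<close>
  have "[[:d:] * F a * (?L * (?L + [:e:])) =
      [:c:] * (?L + [:e:]) * D (a + 0) + [:d - c:] * ?L * D (a + d)] (mod M)"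
    if a: "a \<in> GF q" for a
  proof -
    have "[:d:] * F a * (?L * (?L + [:e:])) =
        [:d:] * D a * D (a + d) * (F a * ([:a + d, 1:] * [:a, 1:]))"
      unfolding w[OF a, symmetric] unfolding z[OF a, symmetric] by (simp only: ac_simps)
    also have "[\<dots> = [:d:] * D a * D (a + d) * [:a + c, 1:]] (mod M)"
      by (rule cong_scalar_left[OF F[OF a]])
    also have "[:d:] * D a * D (a + d) * [:a + c, 1:] = ([:d:] * [:a + c, 1:]) * D a * D (a + d)"
      by (simp only: ac_simps)
    \<comment> \<open>This is the partial fraction identity
      \<open>d * (z + c) = c * (z + d) + (d - c) * z\<close>.\<close>
    also have "[:d:] * [:a + c, 1:] = [:c:] * [:a + d, 1:] + [:d - c:] * [:a, 1:]"
      by (simp add: algebra_simps)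
    also have "\<dots> * D a * D (a + d) =
        [:c:] * ([:a + d, 1:] * D (a + d)) * D a + [:d - c:] * ([:a, 1:] * D a) * D (a + d)"
      by (simp only: ring_distribs ac_simps)
    finally show ?thesis by (simp only: z[OF a] w[OF a] add_0_right)
  qed
  then have "[(\<Sum>a\<in>GF q. [:d:] * F a * (?L * (?L + [:e:]))) =
      (\<Sum>a\<in>GF q. [:c:] * (?L + [:e:]) * D (a + 0) + [:d - c:] * ?L * D (a + d))] (mod M)"
    by (rule cong_sum)
  then have *: "[[:d:] * (\<Sum>a\<in>GF q. F a) * (?L * (?L + [:e:])) =
      [:c:] * (?L + [:e:]) * (- 1) + [:d - c:] * ?L * (- 1)] (mod M)"
    by (simp only: sum.distrib sumD flip: sum_distrib_left sum_distrib_right)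
  have L: "[?L = [:x:]] (mod M)" unfolding M_def by (rule cong_artin_schreier)
  have "[[:d:] * [:v:] * ([:x:] * ([:x:] + [:e:])) = [:d:] * (\<Sum>a\<in>GF q. F a) * (?L * (?L + [:e:]))] (mod M)"
    by (intro cong_mult cong_add cong_refl cong_sym[OF L] cong_sym[OF v])
  also note *
  also have "[[:c:] * (?L + [:e:]) * (- 1) + [:d - c:] * ?L * (- 1) =
      [:c:] * ([:x:] + [:e:]) * (- 1) + [:d - c:] * [:x:] * (- 1)] (mod M)"
    by (intro cong_mult cong_add cong_refl L)
  finally have "[[:d * v * (x * (x + e)):] = [:- c * (x + e) - (d - c) * x:]] (mod M)"
    by (simp add: mult_ac)
  then have "d * v * (x * (x + e)) = - c * (x + e) - (d - c) * x"
    by (rule cong_const_imp_eq) (unfold M_def, rule degree_artin_schreier_const[OF assms(3)])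
  then show ?thesis by (simp add: e_def add_diff_eq)
qed

lemma sum_partial_fractions_square:
  fixes x c v :: "'a::finite_field"
  assumes "CARD('a) = q ^ 2" "q = CHAR('a) ^ k" "q \<ge> 2" "odd q" "k \<ge> 1"
  defines "M \<equiv> [:0, 1:] ^ q - [:0, 1:] - [:x:]"
  assumes F: "\<And>a. a \<in> GF q \<Longrightarrow> [F a * ([:a, 1:] * [:a, 1:]) = [:a + c, 1:]] (mod M)"
    and v: "[(\<Sum>a\<in>GF q. F a) = [:v:]] (mod M)"
  shows "v * (x * x) = c - x"
proof -
  let ?L = "[:0, 1:] ^ q - [:0, 1:] :: 'a poly"
  define D where "D a = [:a, 1:] ^ (q - 1) - 1" for a :: 'a
  have z: "[:a, 1:] * D a = ?L" if "a \<in> GF q" for a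
    using linear_mult_power_pred[OF assms(2,3), of a] that by (simp add: GF_def D_def)
  have q0: "of_nat q = (0 :: 'a poly)"
    using of_nat_q_eq_0[OF assms(2,3)] by (simp add: of_nat_poly)
  have sumD: "(\<Sum>a\<in>GF q. D a) = - 1"
    using sum_linear_power_pred[OF assms(1-3), of 0] card_GF[OF assms(1,3)] q0
    by (simp add: D_def sum_subtractf)
  have q2: "q - 1 = Suc (q - 2)" using assms(3) by simp
  \<comment> \<open>Expanding one factor \<open>D a\<close> as \<open>z ^ (q - 1) - 1\<close> and
    pairing a \<open>z\<close> with the other turns the double pole into a power sum of exponent q -
    2, which vanishes.\<close>
  have D2: "D a * D a = ?L * [:a, 1:] ^ (q - 2) - D a" if "a \<in> GF q" for a
  proof -
    have "D a * D a = [:a, 1:] ^ (q - 2) * ([:a, 1:] * D a) - D a"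
      by (subst (1) D_def) (simp only: q2 power_Suc ring_distribs mult_1_left ac_simps)
    then show ?thesis unfolding z[OF that] by (simp only: mult.commute)
  qed
  have "(\<Sum>a\<in>GF q. D a * D a) = (\<Sum>a\<in>GF q. ?L * [:a, 1:] ^ (q - 2) - D a)"
    by (intro sum.cong refl D2)
  also have "\<dots> = 1"
    by (simp only: sum_subtractf sumD sum_linear_power_pred2[OF assms(1-5)] flip: sum_distrib_left) simp
  finally have sumD2: "(\<Sum>a\<in>GF q. D a * D a) = 1" .
  have "[F a * (?L * ?L) = ?L * D a + [:c:] * (D a * D a)] (mod M)" if a: "a \<in> GF q" for a
  proof -
    have "F a * (?L * ?L) = D a * D a * (F a * ([:a, 1:] * [:a, 1:]))"
      unfolding z[OF a, symmetric] by (simp only: ac_simps)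
    also have "[\<dots> = D a * D a * [:a + c, 1:]] (mod M)"
      by (rule cong_scalar_left[OF F[OF a]])
    also have "[:a + c, 1:] = [:a, 1:] + [:c:]" by simp
    also have "D a * D a * \<dots> = ([:a, 1:] * D a) * D a + [:c:] * (D a * D a)"
      by (simp only: ring_distribs ac_simps)
    finally show ?thesis by (simp only: z[OF a])
  qed
  then have "[(\<Sum>a\<in>GF q. F a * (?L * ?L)) = (\<Sum>a\<in>GF q. ?L * D a + [:c:] * (D a * D a))] (mod M)"
    by (rule cong_sum)
  then have *: "[(\<Sum>a\<in>GF q. F a) * (?L * ?L) = ?L * (- 1) + [:c:] * 1] (mod M)"
    by (simp only: sum.distrib sumD sumD2 flip: sum_distrib_left sum_distrib_right)
  have L: "[?L = [:x:]] (mod M)" unfolding M_def by (rule cong_artin_schreier)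
  have "[[:v:] * ([:x:] * [:x:]) = (\<Sum>a\<in>GF q. F a) * (?L * ?L)] (mod M)"
    by (intro cong_mult cong_sym[OF L] cong_sym[OF v])
  also note *
  also have "[?L * (- 1) + [:c:] * 1 = [:x:] * (- 1) + [:c:] * 1] (mod M)"
    by (intro cong_mult cong_add cong_refl L)
  finally have "[[:v * (x * x):] = [:c - x:]] (mod M)" by (simp add: mult_ac)
  then show ?thesis
    by (rule cong_const_imp_eq) (unfold M_def, rule degree_artin_schreier_const[OF assms(3)])
qed

section \<open>The values of \<open>g_poly n q\<close>\<close>

text \<open>The exponent is \<open>n = q ^ (2 * (h + i)) - q ^ (2 * h + 1) - 1\<close>, given
  additively. Multiplying by the two powers that are subtracted leaves a single iterated q-th power,
  and no inverse of \<open>Y + a\<close> is needed.\<close>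

lemma cong_linear_power_n:
  fixes x a :: "'a::finite_field"
  assumes "CARD('a) = q ^ 2" "q = CHAR('a) ^ k" "a \<in> GF q"
    and "n + q ^ (2 * h + 1) + 1 = q ^ (2 * (h + i))"
  shows "[[:a, 1:] ^ n * ([:a + (x + of_nat h * (x + x ^ q)), 1:] * [:a, 1:]) =
    [:a + of_nat (h + i) * (x + x ^ q), 1:]] (mod [:0, 1:] ^ q - [:0, 1:] - [:x:])"
    (is "[_ = _] (mod ?M)")
proof -
  note A = cong_linear_power(1)[OF assms(1-3), of "h + i" x]
    and B = cong_linear_power(2)[OF assms(1-3), of h x]
  have "[[:a, 1:] ^ n * ([:a + x + of_nat h * (x + x ^ q), 1:] * [:a, 1:]) =
      [:a, 1:] ^ n * ([:a, 1:] ^ (q ^ (2 * h + 1)) * [:a, 1:])] (mod ?M)"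
    by (intro cong_mult cong_refl cong_sym[OF B])
  also have "[:a, 1:] ^ n * ([:a, 1:] ^ (q ^ (2 * h + 1)) * [:a, 1:]) = [:a, 1:] ^ (q ^ (2 * (h + i)))"
    unfolding assms(4)[symmetric] by (simp only: power_add power_one_right mult.assoc)
  also note A
  finally show ?thesis by (simp only: add.assoc)
qed

text \<open>So \<open>h\<close> acts as -1/2, which explains the halves in the closed forms of
  \<open>c\<close> and \<open>d\<close>.\<close>

lemma double_of_nat_char_half:
  assumes "CHAR('a::comm_ring_1) = 2 * h + 1"
  shows "2 * of_nat h = (- 1 :: 'a)"
proof -
  have "2 * of_nat h + 1 = (of_nat (2 * h + 1) :: 'a)" by simp
  also have "\<dots> = 0" unfolding assms[symmetric] by (rule of_nat_CHAR)
  finally show ?thesis by (simp only: eq_neg_iff_add_eq_0)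
qed

lemma poly_g_poly_notin_GF:
  fixes x :: "'a::finite_field"
  assumes "CARD('a) = q ^ 2" "q = CHAR('a) ^ k" "q \<ge> 2" "CHAR('a) = 2 * h + 1"
    and "n + q ^ (2 * h + 1) + 1 = q ^ (2 * (h + i))" "x \<notin> GF q"
  shows "poly (g_poly n q) x = (2 * of_nat i - 1) / x + (2 * of_nat i - 2) / x ^ q"
proof -
  define v where "v = poly (g_poly n q) x"
  define y where "y = x ^ q"
  define d where "d = x + of_nat h * (x + y)"
  define c where "c = of_nat (h + i) * (x + y)"
  have h2: "2 * of_nat h = (- 1 :: 'a)" by (rule double_of_nat_char_half[OF assms(4)])
  have xy: "x \<noteq> y" "x \<noteq> 0" "y \<noteq> 0"
    using assms(3,6) by (auto simp: GF_def y_def power_0_left)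
  have yq: "y ^ q = x" unfolding y_def by (rule power_q_q[OF assms(1)])
  have "of_nat h ^ q = (of_nat h :: 'a)"
    using of_nat_in_GF[OF assms(2)] by (auto simp: GF_def)
  then have "d ^ q = y + of_nat h * (y + x)"
    by (simp add: d_def add_power_q[OF assms(2)] power_mult_distrib yq flip: y_def)
  then have dq: "x + d ^ q - d = y" by (simp add: d_def algebra_simps)
  have "2 * d = 2 * x + (2 * of_nat h) * (x + y)" by (simp add: d_def algebra_simps)
  then have d2: "2 * d = x - y" by (simp add: h2)
  have "2 * c = (2 * of_nat h + 2 * of_nat i) * (x + y)" by (simp add: c_def algebra_simps)
  then have c2: "2 * c = (2 * of_nat i - 1) * (x + y)" by (simp add: h2)
  have "d * v * (x * (x + d ^ q - d)) = - c * (x + d ^ q - d) - (d - c) * x"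
    using cong_linear_power_n[OF assms(1,2) _ assms(5), of _ x]
      cong_sum_g_poly[OF assms(1-3), of n x]
    unfolding c_def d_def y_def v_def by (rule sum_partial_fractions[OF assms(1-3)])
  \<comment> \<open>Doubling removes \<open>h\<close>: \<open>2 * d\<close> and \<open>2 * c\<close>
    are known, and the common factor \<open>x - y\<close> is nonzero because \<open>x\<close> is
    outside \<open>GF q\<close>.\<close>
  then have "2 * (d * v * (x * y)) = 2 * (- c * y - (d - c) * x)" by (simp only: dq)
  then have "(2 * d) * v * (x * y) = (2 * c) * (x - y) - (2 * d) * x"
    by (simp add: algebra_simps)
  then have "(x - y) * (v * (x * y)) = (x - y) * ((2 * of_nat i - 1) * (x + y) - x)"
    unfolding c2 d2 by (simp add: algebra_simps)
  then have "v * (x * y) = (2 * of_nat i - 1) * (x + y) - x"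
    using xy(1) by simp
  then have "v = ((2 * of_nat i - 1) * (x + y) - x) / (x * y)"
    using xy(2,3) by (simp add: nonzero_eq_divide_eq)
  also have "\<dots> = (2 * of_nat i - 1) / x + (2 * of_nat i - 2) / y"
    using xy(2,3) by (simp add: field_simps)
  finally show ?thesis by (simp only: v_def y_def)
qed

lemma poly_g_poly_in_GF:
  fixes x :: "'a::finite_field"
  assumes "CARD('a) = q ^ 2" "q = CHAR('a) ^ k" "q \<ge> 2" "odd q" "k \<ge> 1" "CHAR('a) = 2 * h + 1"
    and n: "n + q ^ (2 * h + 1) + 1 = q ^ (2 * (h + i))" and x: "x \<in> GF q"
  shows "poly (g_poly n q) x = 2 * (of_nat i - 1) * x ^ (q - 2)"
proof (cases "x = 0")
  case True
  \<comment> \<open>At \<open>x = 0\<close> the congruences would require division by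
    \<open>x\<close>. Instead the value is the sum of the \<open>a ^ n\<close>, which vanishes
    because \<open>n\<close> is odd.\<close>
  have "odd (n + q ^ (2 * h + 1) + 1) \<longleftrightarrow> odd (q ^ (2 * (h + i)))" by (simp only: n)
  then have "odd n" using assms(4) by simp
  have "(\<Sum>a\<in>GF q. [:a, 1:] ^ n) = pcompose (g_poly n q :: 'a poly) ([:0, 1:] ^ q - [:0, 1:])"
    using is_g_poly_g_poly[OF assms(1-3), of n] by (simp add: is_g_poly_def)
  from arg_cong[OF this, of "\<lambda>f. poly f 0"]
  have "poly (g_poly n q) 0 = (\<Sum>a\<in>GF q. (a :: 'a) ^ n)"
    using assms(3) by (simp add: poly_sum poly_pcompose power_0_left)
  also have "\<dots> = 0" by (rule sum_odd_power_GF) fact+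
  finally have "poly (g_poly n q) x = 0" using True by simp
  moreover have "q - 2 > 0" using assms(3,4) by (cases "q = 2") auto
  ultimately show ?thesis using True by simp
next
  case False
  define v where "v = poly (g_poly n q) x"
  have h2: "2 * of_nat h = (- 1 :: 'a)" by (rule double_of_nat_char_half[OF assms(6)])
  have xq: "x ^ q = x" using x by (simp add: GF_def)
  \<comment> \<open>On \<open>GF q\<close> the two poles coincide, so the double pole case
    applies.\<close>
  have d: "x + of_nat h * (x + x ^ q) = 0"
  proof -
    have "x + of_nat h * (x + x ^ q) = x + (2 * of_nat h) * x" unfolding xq by (simp add: algebra_simps)
    then show ?thesis by (simp add: h2)
  qed
  have "v * (x * x) = of_nat (h + i) * (x + x ^ q) - x"
    using cong_linear_power_n[OF assms(1,2) _ n, of _ x]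
      cong_sum_g_poly[OF assms(1-3), of n x]
    unfolding v_def d add_0_right by (rule sum_partial_fractions_square[OF assms(1-5)])
  also have "\<dots> = (2 * of_nat h + 2 * of_nat i - 1) * x" unfolding xq by (simp add: algebra_simps)
  also have "\<dots> = 2 * (of_nat i - 1) * x" unfolding h2 by (simp add: algebra_simps)
  finally have "v * x = 2 * (of_nat i - 1)" using False by simp
  moreover have "x ^ (q - 2) * x = 1"
    using GF_power_pred2[OF x] assms(3,4) False by (cases "q = 2") auto
  ultimately have "v * x = (2 * (of_nat i - 1) * x ^ (q - 2)) * x" by (simp only: mult.assoc mult_1_right)
  then show ?thesis using False by (simp add: v_def)
qed

section \<open>The permutation criterion\<close>

text \<open>
  Outside of \<open>GF q\<close> the map is additive in \<open>w = 1 / x\<close>. Its image \<open>(b + 1) * w + b * w ^ q\<close> has the same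
  value of \<open>u ^ q - u\<close> as \<open>w\<close>; hence it stays outside of \<open>GF q\<close>, and its kernel lies in \<open>GF q\<close>.
\<close>

lemma bij_piecewise_iff:
  fixes f :: "'a::finite_field \<Rightarrow> 'a"
  assumes "CARD('a) = q ^ 2" "q = CHAR('a) ^ k" "q \<ge> 2"
    and b: "b \<in> GF q"
    and f_in: "\<And>x. x \<in> GF q \<Longrightarrow> f x = b * inverse x"
    and f_notin: "\<And>x. x \<notin> GF q \<Longrightarrow> f x = (b + 1) * inverse x + b * inverse x ^ q"
  shows "bij f \<longleftrightarrow> b \<noteq> 0 \<and> 2 * b + 1 \<noteq> 0"
proof -
  note cl = GF_closed[where ?'a='a, OF assms(2)]
  have inv_GF: "inverse w \<in> GF q \<longleftrightarrow> w \<in> GF q" for w :: 'a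
    using cl(7)[of w] cl(7)[of "inverse w"] by auto
  define g where "g w = (b + 1) * w + b * w ^ q" for w :: 'a
  have bq: "b ^ q = b" using b by (simp add: GF_def)
  have add: "(u + w) ^ q = u ^ q + w ^ q" for u w :: 'a by (rule add_power_q[OF assms(2)])
  have diff: "(u - w) ^ q = u ^ q - w ^ q" for u w :: 'a
    using add[of "u - w" w] by simp
  have g_frob: "g w ^ q - g w = w ^ q - w" for w
    by (simp add: g_def add power_mult_distrib bq power_q_q[OF assms(1)] algebra_simps)
  have g_notin: "g w \<notin> GF q \<longleftrightarrow> w \<notin> GF q" for w
    using g_frob[of w] by (auto simp: GF_def)
  have f_g: "f x = g (inverse x)" if "x \<notin> GF q" for x
    using f_notin[OF that] by (simp add: g_def)
  show ?thesis
  proof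
    assume "bij f"
    then have inj: "inj f" by (rule bij_is_inj)
    have "b \<noteq> 0"
    proof
      assume "b = 0"
      then have "f 0 = f 1" using f_in cl(1,2) by simp
      then show False using injD[OF inj] by fastforce
    qed
    moreover have "2 * b + 1 \<noteq> 0"
    proof
      assume b2: "2 * b + 1 = 0"
      have "card (GF q :: 'a set) < CARD('a)"
        using card_GF[OF assms(1,3)] assms(1,3) by (simp add: power2_eq_square)
      then obtain w :: 'a where w: "w \<notin> GF q" by (metis UNIV_I less_irrefl subsetI subset_UNIV subset_antisym)
      have w1: "w + 1 \<notin> GF q" using w cl(5)[OF _ cl(2), of "w + 1"] by auto
      \<comment> \<open>If \<open>2 * b + 1\<close> is 0, translation by 1 gives two points outside
        \<open>GF q\<close> with the same image.\<close>
      have "g (w + 1) = g w + (2 * b + 1)" by (simp add: g_def add algebra_simps)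
      then have "f (inverse (w + 1)) = f (inverse w)"
        using w w1 by (simp add: f_g inv_GF b2)
      then have "inverse (w + 1) = inverse w" by (rule injD[OF inj])
      then show False by simp
    qed
    ultimately show "b \<noteq> 0 \<and> 2 * b + 1 \<noteq> 0" ..
  next
    assume *: "b \<noteq> 0 \<and> 2 * b + 1 \<noteq> 0"
    \<comment> \<open>As \<open>f\<close> preserves \<open>GF q\<close> and its complement,
      injectivity can be checked on each piece.\<close>
    have f_GF: "f x \<in> GF q \<longleftrightarrow> x \<in> GF q" for x
    proof (cases "x \<in> GF q")
      case True
      then show ?thesis using f_in[OF True] cl(6)[OF b cl(7)[OF True]] by simp
    next
      case False
      then show ?thesis using f_g[OF False] g_notin inv_GF by simp
    qed
    have "inj f"
    proof (rule injI)
      fix x y assume eq: "f x = f y"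
      show "x = y"
      proof (cases "x \<in> GF q")
        case True
        then have "y \<in> GF q" using f_GF eq by metis
        then show ?thesis using True eq * by (simp add: f_in)
      next
        case False
        then have y: "y \<notin> GF q" using f_GF eq by metis
        define u where "u = inverse x - inverse y"
        have "g (inverse x) = g (inverse y)" using eq False y by (simp add: f_g)
        then have gu: "g u = 0" by (simp add: g_def u_def diff algebra_simps)
        have "u ^ q = u" using g_frob[of u] gu assms(3) by (simp add: power_0_left)
        \<comment> \<open>On \<open>GF q\<close> the map \<open>g\<close> is multiplication by
          \<open>2 * b + 1\<close>.\<close>
        then have "(2 * b + 1) * u = 0" using gu by (simp add: g_def algebra_simps)
        then show ?thesis using * by (simp add: u_def)
      qed
    qed
    then show "bij f" using finite_UNIV_inj_surj[of f] by (simp add: bij_def)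
  qed
qed

theorem theorem5p7:
  fixes p q k i n :: nat
  assumes "prime p" and "odd p"
    and "k \<ge> 1" and "q = p ^ k"
    and "CARD('a::finite_field) = q ^ 2"
    and "0 < i" and "real i \<le> (real p - 1) / 2"
    and "n = q ^ (p + 2 * i - 1) - q ^ p - 1"
  shows "(\<forall>x::'a.
            (x \<in> GF q \<longrightarrow> poly (g_poly n q) x = 2 * (of_nat i - 1) * x ^ (q - 2)) \<and>
            (x \<notin> GF q \<longrightarrow> poly (g_poly n q) x =
               (2 * of_nat i - 1) / x + (2 * of_nat i - 2) / x ^ q)) \<and>
         (permutation_poly (g_poly n q :: 'a poly) \<longleftrightarrow> i > 1 \<and> \<not> [4 * i = 3] (mod p))"
proof -
  have char: "CHAR('a) = p"
    using assms(4,5) by (intro CHAR_eqI[OF assms(1), of "k * 2"]) (simp add: power_mult)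
  have q: "q = CHAR('a) ^ k" using assms(4) char by simp
  have odd_q: "odd q" using assms(2,4) by simp
  have "p \<le> q" using assms(1,3,4) prime_gt_0_nat[OF assms(1)] by (simp add: self_le_power)
  then have q2: "q \<ge> 2" using prime_ge_2_nat[OF assms(1)] by simp
  obtain h where h: "p = 2 * h + 1" using assms(2) by (rule oddE)
  have i_le: "i \<le> h" using assms(7) h by simp
  have n: "n + q ^ (2 * h + 1) + 1 = q ^ (2 * (h + i))"
  proof -
    \<comment> \<open>This bound shows that the natural number subtractions defining
      \<open>n\<close> do not truncate.\<close>
    have "q ^ p + 1 \<le> q ^ p + q ^ p" using q2 by simp
    also have "\<dots> \<le> q ^ Suc p" using q2 by (simp flip: mult_2)
    also have "\<dots> \<le> q ^ (p + 2 * i - 1)" using assms(6) q2 by (intro power_increasing) auto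
    finally have "n + q ^ p + 1 = q ^ (p + 2 * i - 1)" using assms(8) by simp
    moreover have "p + 2 * i - 1 = 2 * (h + i)" using h by simp
    ultimately show ?thesis using h by simp
  qed
  have h': "CHAR('a) = 2 * h + 1" using h char by simp
  note notin = poly_g_poly_notin_GF[OF assms(5) q q2 h' n]
    and in_GF = poly_g_poly_in_GF[OF assms(5) q q2 odd_q assms(3) h' n]
  define b :: 'a where "b = 2 * (of_nat i - 1)"
  have b_nat: "b = of_nat (2 * (i - 1))" using assms(6) by (simp add: b_def of_nat_diff)
  have "permutation_poly (g_poly n q :: 'a poly) \<longleftrightarrow> b \<noteq> 0 \<and> 2 * b + 1 \<noteq> 0"
    unfolding permutation_poly_def
  proof (rule bij_piecewise_iff[OF assms(5) q q2])
    show "b \<in> GF q" unfolding b_nat by (rule of_nat_in_GF[OF q])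
    show "poly (g_poly n q) x = b * inverse x" if x: "x \<in> GF q" for x
      using in_GF[OF x] GF_power_pred2[OF x] q2 odd_q by (cases "q = 2") (auto simp: b_def)
    show "poly (g_poly n q) x = (b + 1) * inverse x + b * inverse x ^ q" if "x \<notin> GF q" for x
      using notin[OF that] by (simp add: b_def divide_inverse power_inverse algebra_simps)
  qed
  moreover have "b = 0 \<longleftrightarrow> i = 1"
  proof -
    have "b = 0 \<longleftrightarrow> p dvd 2 * (i - 1)" unfolding b_nat of_nat_eq_0_iff_char_dvd char ..
    \<comment> \<open>The upper bound on \<open>i\<close> leaves 0 as the only possible multiple of
      \<open>p\<close>.\<close>
    moreover have "2 * (i - 1) < p" using i_le h by simp
    ultimately show ?thesis using assms(6) by (auto dest: dvd_imp_le)
  qed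
  moreover have "2 * b + 1 = 0 \<longleftrightarrow> [4 * i = 3] (mod p)"
  proof -
    have "2 * b + 1 = of_nat (4 * i) - of_nat 3" by (simp add: b_def algebra_simps)
    then have "2 * b + 1 = 0 \<longleftrightarrow> of_nat (4 * i) = (of_nat 3 :: 'a)" by (simp only: right_minus_eq)
    then show ?thesis by (simp only: of_nat_eq_iff_cong_CHAR char)
  qed
  ultimately show ?thesis using notin in_GF assms(6) by auto
qed

end
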